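(* Let $S$ be an inverse semigroup which has a zero element $0$ and has no unit (identity element), and in which all projections are mutually orthogonal, i.e. $ef=0$ for any two distinct idempotents $e,f\in S$. Then there exists a groupoid $G(S)$ whose underlying set is $S\setminus\{0\}$ and whose multiplication is restricted from $S$, i.e. for every composable pair $(x,y)$ of $G(S)$ the product of $x$ and $y$ in $G(S)$ equals their product in $S$.
   Context: An inverse semigroup is a semigroup $P$ such that for every $x\in P$ there is a unique $x^*\in P$ with $xx^*x=x$ and $x^*xx^*=x^*$. A zero element of a semigroup $P$ is an element $0\in P$ with $0x=x0=0$ for all $x\in P$. Projections in an inverse semigroup are its idempotents. A groupoid is a set $G$ together with a subset $G^2\subset G\times G$ (the composable pairs), a product map $(a,b)\mapsto ab$ from $G^2$ to $G$, and an inverse map $a\mapsto a^{-1}$ from $G$ onto $G$ with $(a^{-1})^{-1}=a$, such that: (1) if $(a,b),(b,c)\in G^2$, then $(ab,c),(a,bc)\in G^2$ and $(ab)c=a(bc)$; (2) $(b,b^{-1})\in G^2$ for all $b\in G$, and if $(a,b)\in G^2$, then $a^{-1}(ab)=b$ and $(ab)b^{-1}=a$. *)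

theory Defs
  imports Main
begin

locale inverse_semigroup =
  fixes P :: "'a set" and mult :: "'a \<Rightarrow> 'a \<Rightarrow> 'a" (infixl "\<cdot>" 70)
  assumes mult_closed: "\<lbrakk>x \<in> P; y \<in> P\<rbrakk> \<Longrightarrow> x \<cdot> y \<in> P"
    and mult_assoc: "\<lbrakk>x \<in> P; y \<in> P; z \<in> P\<rbrakk> \<Longrightarrow> (x \<cdot> y) \<cdot> z = x \<cdot> (y \<cdot> z)"
    and ex1_inverse: "x \<in> P \<Longrightarrow> \<exists>!y. y \<in> P \<and> x \<cdot> y \<cdot> x = x \<and> y \<cdot> x \<cdot> y = y"

definition is_zero :: "'a set \<Rightarrow> ('a \<Rightarrow> 'a \<Rightarrow> 'a) \<Rightarrow> 'a \<Rightarrow> bool" where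
  "is_zero P mult z \<longleftrightarrow> z \<in> P \<and> (\<forall>x\<in>P. mult z x = z \<and> mult x z = z)"

definition is_unit_element :: "'a set \<Rightarrow> ('a \<Rightarrow> 'a \<Rightarrow> 'a) \<Rightarrow> 'a \<Rightarrow> bool" where
  "is_unit_element P mult u \<longleftrightarrow> u \<in> P \<and> (\<forall>x\<in>P. mult u x = x \<and> mult x u = x)"

definition projections :: "'a set \<Rightarrow> ('a \<Rightarrow> 'a \<Rightarrow> 'a) \<Rightarrow> 'a set" where
  "projections P mult = {e \<in> P. mult e e = e}"

(* The product is a partial map: prd a b is meaningful only for (a, b) in G2, and the
   values of prd elsewhere are irrelevant.  The composability of (inv a, prd a b) and
   (prd a b, inv b) implicit in inv_prd and prd_inv follows from the other axioms. *)
locale groupoid =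
  fixes G :: "'a set" and G2 :: "('a \<times> 'a) set"
    and prd :: "'a \<Rightarrow> 'a \<Rightarrow> 'a" and inv :: "'a \<Rightarrow> 'a"
  assumes composable_subset: "G2 \<subseteq> G \<times> G"
    and prd_closed: "(a, b) \<in> G2 \<Longrightarrow> prd a b \<in> G"
    and inv_onto: "inv ` G = G"
    and inv_inv: "a \<in> G \<Longrightarrow> inv (inv a) = a"
    and prd_composable_left: "\<lbrakk>(a, b) \<in> G2; (b, c) \<in> G2\<rbrakk> \<Longrightarrow> (prd a b, c) \<in> G2"
    and prd_composable_right: "\<lbrakk>(a, b) \<in> G2; (b, c) \<in> G2\<rbrakk> \<Longrightarrow> (a, prd b c) \<in> G2"
    and prd_assoc: "\<lbrakk>(a, b) \<in> G2; (b, c) \<in> G2\<rbrakk> \<Longrightarrow> prd (prd a b) c = prd a (prd b c)"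
    and inv_composable: "b \<in> G \<Longrightarrow> (b, inv b) \<in> G2"
    and inv_prd: "(a, b) \<in> G2 \<Longrightarrow> prd (inv a) (prd a b) = b"
    and prd_inv: "(a, b) \<in> G2 \<Longrightarrow> prd (prd a b) (inv b) = a"

end

theory Submission
  imports Defs
begin

text \<open>
  Declare \<open>(x, y)\<close> composable when the source projection \<open>x\<^sup>* x\<close> equals the range projection
  \<open>y y\<^sup>*\<close>. For such pairs \<open>y\<^sup>* x\<^sup>*\<close> is an inverse of \<open>x y\<close>, with \<open>(x y)\<^sup>* (x y) = y\<^sup>* y\<close> and
  \<open>(x y) (x y)\<^sup>* = x x\<^sup>*\<close>, and \<open>x y = 0\<close> would force \<open>y = x\<^sup>* x y = 0\<close>.
\<close>

context inverse_semigroup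
begin

definition star :: "'a \<Rightarrow> 'a" where
  "star x = (THE y. y \<in> P \<and> x \<cdot> y \<cdot> x = x \<and> y \<cdot> x \<cdot> y = y)"

lemma
  assumes "x \<in> P"
  shows star_closed: "star x \<in> P"
    and mult_star_mult: "x \<cdot> star x \<cdot> x = x"
    and star_mult_star: "star x \<cdot> x \<cdot> star x = star x"
  using theI'[OF ex1_inverse[OF assms]] by (simp_all add: star_def)

lemma star_eqI:
  assumes "x \<in> P" "y \<in> P" "x \<cdot> y \<cdot> x = x" "y \<cdot> x \<cdot> y = y"
  shows "star x = y"
  unfolding star_def using assms by (intro the1_equality ex1_inverse) simp_all

lemma star_star: "x \<in> P \<Longrightarrow> star (star x) = x"
  by (simp add: star_eqI star_closed mult_star_mult star_mult_star)

text \<open>The pairs range over all of \<open>P\<close>, zero included, so that the algebra below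
  makes no mention of zero; \<open>groupoid_nonzero\<close> restricts to nonzero elements.\<close>

definition composable :: "('a \<times> 'a) set" where
  "composable = {(x, y). x \<in> P \<and> y \<in> P \<and> star x \<cdot> x = y \<cdot> star y}"

lemma composableD:
  assumes "(x, y) \<in> composable"
  shows "x \<in> P" "y \<in> P" "star x \<cdot> x = y \<cdot> star y"
  using assms by (simp_all add: composable_def)

lemma star_composable: "x \<in> P \<Longrightarrow> (x, star x) \<in> composable"
  by (simp add: composable_def star_closed star_star)

text \<open>Rebracketing turns \<open>star x \<cdot> x\<close> into \<open>y \<cdot> star y\<close>,
  which fixes \<open>y\<close> from the left.\<close>

lemma star_mult_cancel:
  assumes "(x, y) \<in> composable"
  shows "star x \<cdot> (x \<cdot> y) = y"
  using composableD[OF assms] by (metis mult_assoc mult_star_mult star_closed)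

lemma mult_star_cancel:
  assumes "(x, y) \<in> composable"
  shows "x \<cdot> y \<cdot> star y = x"
  using composableD[OF assms] by (metis mult_assoc mult_star_mult star_closed)

text \<open>Composability depends only on source and range projections, so these two identities
  carry it over to products. The cancellation laws yield
  \<open>star (x \<cdot> y) = star y \<cdot> star x\<close> without commuting idempotents.\<close>

lemma
  assumes "(x, y) \<in> composable"
  shows source_mult: "star (x \<cdot> y) \<cdot> (x \<cdot> y) = star y \<cdot> y"
    and range_mult: "x \<cdot> y \<cdot> star (x \<cdot> y) = x \<cdot> star x"
proof -
  note xy = composableD(1,2)[OF assms]
  note closed = xy xy[THEN star_closed] mult_closed
  have range_eq: "x \<cdot> y \<cdot> (star y \<cdot> star x) = x \<cdot> star x"
    using closed mult_star_cancel[OF assms] by (metis mult_assoc)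
  have source_eq: "star y \<cdot> star x \<cdot> (x \<cdot> y) = star y \<cdot> y"
    using closed star_mult_cancel[OF assms] by (metis mult_assoc)
  have "star (x \<cdot> y) = star y \<cdot> star x"
  proof (rule star_eqI)
    \<comment> \<open>The left factor collapses to \<open>x \<cdot> star x\<close>, which is
      absorbed by the leading \<open>x\<close>.\<close>
    show "x \<cdot> y \<cdot> (star y \<cdot> star x) \<cdot> (x \<cdot> y) = x \<cdot> y"
      unfolding range_eq using closed mult_star_mult by (metis mult_assoc)
    show "star y \<cdot> star x \<cdot> (x \<cdot> y) \<cdot> (star y \<cdot> star x) = star y \<cdot> star x"
      unfolding source_eq using closed star_mult_star by (metis mult_assoc)
  qed (simp_all add: closed)
  with range_eq source_eq
  show "star (x \<cdot> y) \<cdot> (x \<cdot> y) = star y \<cdot> y" "x \<cdot> y \<cdot> star (x \<cdot> y) = x \<cdot> star x"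
    by simp_all
qed

lemma mult_composable_left:
  "\<lbrakk>(a, b) \<in> composable; (b, c) \<in> composable\<rbrakk> \<Longrightarrow> (a \<cdot> b, c) \<in> composable"
  using source_mult[of a b] by (auto simp: composable_def mult_closed)

lemma mult_composable_right:
  "\<lbrakk>(a, b) \<in> composable; (b, c) \<in> composable\<rbrakk> \<Longrightarrow> (a, b \<cdot> c) \<in> composable"
  using range_mult[of b c] by (auto simp: composable_def mult_closed)

text \<open>If \<open>star x\<close> were \<open>z\<close>, then
  \<open>x = x \<cdot> star x \<cdot> x\<close> would be \<open>z\<close> too.\<close>

lemma star_nonzero:
  assumes "is_zero P (\<cdot>) z" "x \<in> P - {z}"
  shows "star x \<in> P - {z}"
  using assms mult_star_mult[of x] star_closed[of x] by (auto simp: is_zero_def)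

lemma mult_nonzero:
  assumes "is_zero P (\<cdot>) z" "(x, y) \<in> composable" "y \<noteq> z"
  shows "x \<cdot> y \<in> P - {z}"
  using assms star_mult_cancel[of x y] composableD[of x y] star_closed[of x]
  by (auto simp: is_zero_def mult_closed)

lemma groupoid_nonzero:
  assumes zero: "is_zero P (\<cdot>) z"
  shows "groupoid (P - {z}) (composable \<inter> (P - {z}) \<times> (P - {z})) (\<cdot>) star"
proof
  show "star ` (P - {z}) = P - {z}"
  proof
    show "star ` (P - {z}) \<subseteq> P - {z}"
      using star_nonzero[OF zero] by blast
    \<comment> \<open>Each element is the image of its own \<open>star\<close>.\<close>
    show "P - {z} \<subseteq> star ` (P - {z})"
      using star_nonzero[OF zero] star_star by (metis Diff_iff image_eqI subsetI)
  qed
next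
  fix b assume "b \<in> P - {z}"
  then show "(b, star b) \<in> composable \<inter> (P - {z}) \<times> (P - {z})"
    using star_nonzero[OF zero] star_composable by auto
\<comment> \<open>\<open>mult_nonzero\<close> keeps products inside \<open>P - {z}\<close>; the
  axioms \<open>inv_prd\<close> and \<open>prd_inv\<close> are the two cancellation laws.\<close>
qed (use mult_nonzero[OF zero] mult_composable_left mult_composable_right
    in \<open>auto simp: star_star mult_assoc star_mult_cancel mult_star_cancel\<close>)

end

theorem lemma1p5:
  fixes S :: "'a set" and mult :: "'a \<Rightarrow> 'a \<Rightarrow> 'a" and z :: 'a
  assumes "inverse_semigroup S mult"
    and "is_zero S mult z"
    and "\<not> (\<exists>u. is_unit_element S mult u)"
    and "\<And>e f. \<lbrakk>e \<in> projections S mult; f \<in> projections S mult; e \<noteq> f\<rbrakk> \<Longrightarrow> mult e f = z"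
  shows "\<exists>G2 prd inv. groupoid (S - {z}) G2 prd inv \<and> (\<forall>(x, y) \<in> G2. prd x y = mult x y)"
  using inverse_semigroup.groupoid_nonzero[OF assms(1,2)] by blast

end
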